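(* Let $\Omega$ be a finite signature. On any countably infinite $\Omega$-algebra $A$, and on any linear $\Omega$-algebra $A$ over a field $F$ of countably infinite dimension, there are at least continuum many pairwise non-equivalent tame filtrations. Moreover, given any function $g:\mathbb{N}\to\mathbb{N}$, one can always choose two tame filtrations $\alpha=\{A_n\}$ and $\alpha'=\{A'_n\}$ on $A$ so that the distortion function $f=\mathrm{dist}_{\alpha}^{\alpha'}$ satisfies $f(n)>g(n)$ for all $n>0$.
   Context: An $\Omega$-algebra is a set with operations indexed by $\Omega$ (of finite arities, nullary and unary operations allowed). A linear $\Omega$-algebra is a vector space over a field $F$ with multilinear operations indexed by $\Omega$. A filtration on an $\Omega$-algebra (respectively linear $\Omega$-algebra) $A$ is an ascending chain $A_0\subset A_1\subset\cdots$ of subsets (respectively subspaces) of $A$ with $A=\bigcup_{n\ge 0}A_n$ such that for every $m$-ary operation $\omega\in\Omega$ and all $a_1\in A_{i_1},\dots,a_m\in A_{i_m}$ one has $a_1\cdots a_m\omega\in A_{i_1+\cdots+i_m+1}$. All filtrations are assumed finitary: every $A_n$ is finite (respectively finite-dimensional). A filtration $\{A_n\}$ is tame if there is $c>0$ such that $\#A_n\le c^n$ (respectively $\dim A_n\le c^n$) for all $n\ge 1$. Two filtrations $\{B_n\}$, $\{B'_n\}$ on the same algebra are equivalent if there is an integer $t>0$ such that $B_n\subset B'_{tn}$ and $B'_n\subset B_{tn}$ for all $n\ge 0$. The distortion function of $\alpha'=\{A'_n\}$ with respect to $\alpha=\{A_n\}$ is $\mathrm{dist}_{\alpha}^{\alpha'}(n)=\min\{m\mid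 A_n\subset A'_m\}$. *)

theory Defs
  imports Complex_Main "HOL-Library.Equipollence" "HOL-Library.Countable_Set"
begin

text \<open>A signature is a set \<open>\<Omega>\<close> of operation symbols with an arity function \<open>ar\<close>. The value of the
  symbol \<open>\<omega>\<close> on the arguments \<open>xs\<close> is \<open>opr \<omega> xs\<close>; it is relevant only if \<open>length xs = ar \<omega>\<close>.\<close>

locale omega_algebra =
  fixes \<Omega> :: "'o set" and ar :: "'o \<Rightarrow> nat" and opr :: "'o \<Rightarrow> 'a list \<Rightarrow> 'a" and A :: "'a set"
  assumes opr_closed:
    "\<lbrakk>\<omega> \<in> \<Omega>; length xs = ar \<omega>; set xs \<subseteq> A\<rbrakk> \<Longrightarrow> opr \<omega> xs \<in> A"

text \<open>The underlying vector space of a linear algebra is the whole type \<open>'v\<close>.\<close>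

locale linear_omega_algebra = vector_space scale
  for scale :: "'f::field \<Rightarrow> 'v::ab_group_add \<Rightarrow> 'v" +
  fixes \<Omega> :: "'o set" and ar :: "'o \<Rightarrow> nat" and opr :: "'o \<Rightarrow> 'v list \<Rightarrow> 'v"
  assumes opr_multilinear:
    "\<lbrakk>\<omega> \<in> \<Omega>; length xs = ar \<omega>; i < ar \<omega>\<rbrakk>
      \<Longrightarrow> Vector_Spaces.linear scale scale (\<lambda>x. opr \<omega> (xs[i := x]))"

text \<open>The part of the definition of a filtration common to both kinds of algebra. A nullary
  operation (\<open>xs = ks = []\<close>) has its value in \<open>\<alpha> 1\<close>.\<close>

definition filtration_chain ::
  "'o set \<Rightarrow> ('o \<Rightarrow> nat) \<Rightarrow> ('o \<Rightarrow> 'a list \<Rightarrow> 'a) \<Rightarrow> 'a set \<Rightarrow> (nat \<Rightarrow> 'a set) \<Rightarrow> bool" where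
  "filtration_chain \<Omega> ar opr A \<alpha> \<longleftrightarrow>
     (\<forall>n. \<alpha> n \<subseteq> \<alpha> (Suc n)) \<and>
     (\<Union>n. \<alpha> n) = A \<and>
     (\<forall>\<omega>\<in>\<Omega>. \<forall>xs ks. length xs = ar \<omega> \<and> list_all2 (\<lambda>x k. x \<in> \<alpha> k) xs ks
        \<longrightarrow> opr \<omega> xs \<in> \<alpha> (sum_list ks + 1))"

definition filtration ::
  "'o set \<Rightarrow> ('o \<Rightarrow> nat) \<Rightarrow> ('o \<Rightarrow> 'a list \<Rightarrow> 'a) \<Rightarrow> 'a set \<Rightarrow> (nat \<Rightarrow> 'a set) \<Rightarrow> bool" where
  "filtration \<Omega> ar opr A \<alpha> \<longleftrightarrow> filtration_chain \<Omega> ar opr A \<alpha> \<and> (\<forall>n. finite (\<alpha> n))"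

definition tame_filtration ::
  "'o set \<Rightarrow> ('o \<Rightarrow> nat) \<Rightarrow> ('o \<Rightarrow> 'a list \<Rightarrow> 'a) \<Rightarrow> 'a set \<Rightarrow> (nat \<Rightarrow> 'a set) \<Rightarrow> bool" where
  "tame_filtration \<Omega> ar opr A \<alpha> \<longleftrightarrow>
     filtration \<Omega> ar opr A \<alpha> \<and> (\<exists>c::real. c > 0 \<and> (\<forall>n\<ge>1. real (card (\<alpha> n)) \<le> c ^ n))"

context linear_omega_algebra
begin

definition finite_dim :: "'v set \<Rightarrow> bool" where
  "finite_dim V \<longleftrightarrow> (\<exists>B. finite B \<and> span B = V)"

definition countably_infinite_dim :: bool where
  "countably_infinite_dim \<longleftrightarrow>
     (\<exists>B. independent B \<and> span B = UNIV \<and> countable B \<and> infinite B)"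

definition linear_filtration :: "(nat \<Rightarrow> 'v set) \<Rightarrow> bool" where
  "linear_filtration \<alpha> \<longleftrightarrow>
     filtration_chain \<Omega> ar opr UNIV \<alpha> \<and> (\<forall>n. subspace (\<alpha> n) \<and> finite_dim (\<alpha> n))"

definition tame_linear_filtration :: "(nat \<Rightarrow> 'v set) \<Rightarrow> bool" where
  "tame_linear_filtration \<alpha> \<longleftrightarrow>
     linear_filtration \<alpha> \<and> (\<exists>c::real. c > 0 \<and> (\<forall>n\<ge>1. real (dim (\<alpha> n)) \<le> c ^ n))"

end

definition equivalent_filtrations :: "(nat \<Rightarrow> 'a set) \<Rightarrow> (nat \<Rightarrow> 'a set) \<Rightarrow> bool" where
  "equivalent_filtrations \<beta> \<beta>' \<longleftrightarrow>
     (\<exists>t>0. \<forall>n. \<beta> n \<subseteq> \<beta>' (t * n) \<and> \<beta>' n \<subseteq> \<beta> (t * n))"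

text \<open>For filtrations of the same algebra the minimum exists, since \<open>\<alpha> n\<close> is finite (respectively
  finite-dimensional) and \<open>\<alpha>'\<close> is ascending and exhausts the algebra.\<close>

definition distortion :: "(nat \<Rightarrow> 'a set) \<Rightarrow> (nat \<Rightarrow> 'a set) \<Rightarrow> nat \<Rightarrow> nat" where
  "distortion \<alpha> \<alpha>' n = (LEAST m. \<alpha> n \<subseteq> \<alpha>' m)"

end

theory Submission
  imports Defs "HOL-Library.Countable"
begin

text \<open>Weights on generators give filtrations. Assign to the elements of a generating set positive
  degrees, at most two elements to each degree, and let \<open>F n\<close> consist of the values of all terms in
  which the degrees of the generators and the number of operation symbols, with multiplicity, add up
  to at most \<open>n\<close>. This is a filtration, and it is tame for any such choice of degrees: writing a
  generator of degree \<open>n\<close> in unary, a term becomes a word in postfix notation over a fixed finite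
  alphabet, whose length is the degree of the term (\<open>generated_growth\<close>). For a linear algebra the degrees are given to a
  basis, and the filtration is formed by the spans of the sets \<open>F n\<close>;
  multilinearity makes this a filtration (\<open>span_generated_chain\<close>).

  A basic assignment gives each degree one element of an enumeration \<open>e\<close> of the generators. What
  makes the theorem true is the freedom that remains: a second element may be added in any degree
  \<open>n\<close>, and this element can be as far away as desired, because the sets of a filtration are finite
  (finite-dimensional) and the algebra is not.

  For the distortion, the element \<open>x n\<close> added in degree \<open>n\<close> is taken outside the \<open>g n\<close>-th set of the
  basic filtration, and the filtration with these elements is compared with the basic one
  (\<open>large_distortion\<close>).

  For the continuum of filtrations, the degrees available for additional elements are
  the numbers \<open>fact (k + 1)\<close>, and the element \<open>x n\<close> in degree \<open>n\<close> is chosen outside everything that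
  has degree at most \<open>n * n\<close> when all additional elements of smaller degree are present. The
  filtration of a real number \<open>r\<close> uses those \<open>k\<close> for which the \<open>k\<close>-th rational number lies below \<open>r\<close>.
  If \<open>r < s\<close>, infinitely many degrees \<open>n = fact (k + 1)\<close> are used for \<open>s\<close> and not for \<open>r\<close>. For a given
  factor \<open>t\<close> and large such \<open>n\<close>, the next factorial exceeds \<open>t * n\<close>, so that the \<open>t * n\<close>-th set for \<open>r\<close>
  only depends on additional elements of degree less than \<open>n\<close> and does not contain \<open>x n\<close>. Hence no
  factor \<open>t\<close> shows the two filtrations to be equivalent (\<open>not_equivalent\<close>).\<close>

section \<open>The filtration generated by elements of given degrees\<close>

text \<open>Here \<open>D k\<close> is the set of generators of degree \<open>k\<close>. Both rules admit any larger bound \<open>n\<close>, so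
  that the filtration is ascending without a rule of its own.\<close>

inductive degree_le ::
  "'o set \<Rightarrow> ('o \<Rightarrow> nat) \<Rightarrow> ('o \<Rightarrow> 'a list \<Rightarrow> 'a) \<Rightarrow> (nat \<Rightarrow> 'a set) \<Rightarrow> 'a \<Rightarrow> nat \<Rightarrow> bool"
  for \<Omega> ar opr D
  where
    generator: "a \<in> D k \<Longrightarrow> k \<le> n \<Longrightarrow> degree_le \<Omega> ar opr D a n"
  | operation: "\<omega> \<in> \<Omega> \<Longrightarrow> length xs = ar \<omega> \<Longrightarrow>
      list_all2 (\<lambda>x k. degree_le \<Omega> ar opr D x k) xs ks \<Longrightarrow> sum_list ks + 1 \<le> n \<Longrightarrow>
      degree_le \<Omega> ar opr D (opr \<omega> xs) n"

definition generated ::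
  "'o set \<Rightarrow> ('o \<Rightarrow> nat) \<Rightarrow> ('o \<Rightarrow> 'a list \<Rightarrow> 'a) \<Rightarrow> (nat \<Rightarrow> 'a set) \<Rightarrow> nat \<Rightarrow> 'a set"
  where "generated \<Omega> ar opr D n = {x. degree_le \<Omega> ar opr D x n}"

lemma degree_le_mono: "degree_le \<Omega> ar opr D x m \<Longrightarrow> m \<le> n \<Longrightarrow> degree_le \<Omega> ar opr D x n"
  by (erule degree_le.cases) (auto intro: degree_le.intros)

lemma generated_mono: "m \<le> n \<Longrightarrow> generated \<Omega> ar opr D m \<subseteq> generated \<Omega> ar opr D n"
  using degree_le_mono by (fastforce simp: generated_def)

lemma generator_in_generated: "a \<in> D n \<Longrightarrow> a \<in> generated \<Omega> ar opr D n"
  by (auto simp: generated_def intro: degree_le.generator)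

lemma operation_in_generated:
  assumes "\<omega> \<in> \<Omega>" "length xs = ar \<omega>" "list_all2 (\<lambda>x k. x \<in> generated \<Omega> ar opr D k) xs ks"
  shows "opr \<omega> xs \<in> generated \<Omega> ar opr D (sum_list ks + 1)"
  using assms by (auto simp: generated_def intro: degree_le.operation)

lemma generated_closed:
  assumes closed: "\<And>\<omega> xs. \<omega> \<in> \<Omega> \<Longrightarrow> length xs = ar \<omega> \<Longrightarrow> set xs \<subseteq> A \<Longrightarrow> opr \<omega> xs \<in> A"
    and gens: "\<And>k. D k \<subseteq> A"
  shows "generated \<Omega> ar opr D n \<subseteq> A"
proof -
  have "x \<in> A" if "degree_le \<Omega> ar opr D x n" for x
    using that
  proof (induction rule: degree_le.induct)
    case (generator a k n)
    then show ?case using gens by blast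
  next
    case (operation \<omega> xs ks n)
    from operation.IH have "set xs \<subseteq> A"
      by (auto simp: list_all2_conv_all_nth in_set_conv_nth)
    with operation(1,2) show ?case by (rule closed)
  qed
  then show ?thesis by (auto simp: generated_def)
qed

text \<open>Generators of degree greater than \<open>N\<close> do not occur in a term of degree at most \<open>N\<close>.\<close>

lemma generated_local:
  assumes "\<And>k. k \<le> N \<Longrightarrow> D k \<subseteq> D' k"
  shows "generated \<Omega> ar opr D N \<subseteq> generated \<Omega> ar opr D' N"
proof -
  have "degree_le \<Omega> ar opr D' x n" if "degree_le \<Omega> ar opr D x n" "n \<le> N" for x n
    using that
  proof (induction rule: degree_le.induct)
    case (generator a k n)
    then have "a \<in> D' k" using assms[of k] by auto
    then show ?case using generator by (blast intro: degree_le.generator)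
  next
    case (operation \<omega> xs ks n)
    have "k \<le> N" if "k \<in> set ks" for k
      using member_le_sum_list[OF that] operation(3,5) by linarith
    then have "list_all2 (\<lambda>x k. degree_le \<Omega> ar opr D' x k) xs ks"
      using operation.IH by (auto elim!: list.rel_mono_strong)
    with operation show ?case by (blast intro: degree_le.operation)
  qed
  then show ?thesis by (auto simp: generated_def)
qed

section \<open>Exponential growth\<close>

text \<open>The letters of postfix notation. A run of \<open>c\<close> ticks followed by a \<open>Push\<close> stands for one of the two
  generators of degree \<open>c + 1\<close>; \<open>Idle\<close> does nothing and pads all words to the same length.
  Evaluation on a stack maps words to elements, so that it bounds the number of elements by the
  number of words.\<close>

datatype 'o letter = Tick | Push bool | Apply 'o | Idle

fun run_letter ::
  "('o \<Rightarrow> nat) \<Rightarrow> ('o \<Rightarrow> 'a list \<Rightarrow> 'a) \<Rightarrow> (nat \<Rightarrow> 'a) \<Rightarrow> (nat \<Rightarrow> 'a) \<Rightarrow>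
   'o letter \<Rightarrow> nat \<times> 'a list \<Rightarrow> nat \<times> 'a list"
  where
    "run_letter ar opr p q Tick (c, st) = (Suc c, st)"
  | "run_letter ar opr p q (Push b) (c, st) = (0, (if b then p c else q c) # st)"
  | "run_letter ar opr p q (Apply \<omega>) (c, st) =
      (c, opr \<omega> (rev (take (ar \<omega>) st)) # drop (ar \<omega>) st)"
  | "run_letter ar opr p q Idle s = s"

definition alphabet :: "'o set \<Rightarrow> 'o letter set"
  where "alphabet \<Omega> = {Tick, Push True, Push False, Idle} \<union> Apply ` \<Omega>"

lemma fold_ticks:
  "fold (run_letter ar opr p q) (replicate k Tick) (c, st) = (c + k, st)"
  by (induction k arbitrary: c) auto

lemma fold_idle: "fold (run_letter ar opr p q) (replicate k Idle) s = s"
  by (induction k) auto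

text \<open>The words of several arguments are concatenated; their values then lie on the stack in reverse
  order.\<close>

lemma concatenated_words:
  assumes "list_all2 (\<lambda>x k. \<exists>u. set u \<subseteq> L \<and> length u = k \<and>
      (\<forall>st. fold f u (c, st) = (c, x # st))) xs ks"
  shows "\<exists>u. set u \<subseteq> L \<and> length u = sum_list ks \<and> (\<forall>st. fold f u (c, st) = (c, rev xs @ st))"
  using assms
proof (induction rule: list_all2_induct)
  case Nil
  then show ?case by (intro exI[of _ "[]"]) simp
next
  case (Cons x xs k ks)
  then obtain u v where "set u \<subseteq> L" "length u = k" "\<forall>st. fold f u (c, st) = (c, x # st)"
    "set v \<subseteq> L" "length v = sum_list ks" "\<forall>st. fold f v (c, st) = (c, rev xs @ st)"
    by blast
  then show ?case by (intro exI[of _ "u @ v"]) simp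
qed

lemma word_of_degree_le:
  assumes D0: "D 0 = {}" and DS: "\<And>c. D (Suc c) \<subseteq> {p c, q c}"
    and "degree_le \<Omega> ar opr D x n"
  shows "\<exists>u. set u \<subseteq> alphabet \<Omega> \<and> length u = n \<and>
    (\<forall>st. fold (run_letter ar opr p q) u (0, st) = (0, x # st))"
  using assms(3)
proof (induction rule: degree_le.induct)
  case (generator a k n)
  with D0 obtain c where k: "k = Suc c" by (cases k) auto
  with generator DS[of c] obtain b where b: "a = (if b then p c else q c)"
    by (metis (full_types) insertE singletonD subsetD)
  let ?u = "replicate c Tick @ [Push b] @ replicate (n - k) Idle"
  have "set ?u \<subseteq> alphabet \<Omega>" by (cases b) (auto simp: alphabet_def)
  moreover have "length ?u = n" using generator k by simp
  moreover have "fold (run_letter ar opr p q) ?u (0, st) = (0, a # st)" for st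
    using b by (simp add: fold_ticks fold_idle del: fold_replicate)
  ultimately show ?case by blast
next
  case (operation \<omega> xs ks n)
  have "list_all2 (\<lambda>x k. \<exists>u. set u \<subseteq> alphabet \<Omega> \<and> length u = k \<and>
      (\<forall>st. fold (run_letter ar opr p q) u (0, st) = (0, x # st))) xs ks"
    using operation.IH by (auto elim!: list.rel_mono_strong)
  from concatenated_words[OF this] obtain u where
    u: "set u \<subseteq> alphabet \<Omega>" "length u = sum_list ks"
       "\<And>st. fold (run_letter ar opr p q) u (0, st) = (0, rev xs @ st)"
    by blast
  let ?u = "u @ [Apply \<omega>] @ replicate (n - (sum_list ks + 1)) Idle"
  have "set ?u \<subseteq> alphabet \<Omega>" using u operation(1) by (auto simp: alphabet_def)
  moreover have "length ?u = n" using operation(3) u by simp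
  moreover have "fold (run_letter ar opr p q) ?u (0, st) = (0, opr \<omega> xs # st)" for st
    using u operation(2) by (simp add: fold_idle del: fold_replicate)
  ultimately show ?case by blast
qed

lemma generated_growth:
  fixes \<Omega> :: "'o set"
  assumes "finite \<Omega>" and "D 0 = {}" and "\<And>c. D (Suc c) \<subseteq> {p c, q c}"
  shows "finite (generated \<Omega> ar opr D n)"
    and "card (generated \<Omega> ar opr D n) \<le> card (alphabet \<Omega>) ^ n"
proof -
  let ?W = "{u. set u \<subseteq> alphabet \<Omega> \<and> length u = n}"
  let ?value = "\<lambda>u. hd (snd (fold (run_letter ar opr p q) u (0, [])))"
  have fin: "finite (alphabet \<Omega>)" using assms(1) by (simp add: alphabet_def)
  have sub: "generated \<Omega> ar opr D n \<subseteq> ?value ` ?W"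
  proof
    fix x assume "x \<in> generated \<Omega> ar opr D n"
    then have "degree_le \<Omega> ar opr D x n" by (simp add: generated_def)
    from word_of_degree_le[OF assms(2,3) this]
    obtain u where "set u \<subseteq> alphabet \<Omega>" "length u = n"
      "\<forall>st. fold (run_letter ar opr p q) u (0, st) = (0, x # st)"
      by (elim exE conjE)
    then show "x \<in> ?value ` ?W" by (intro image_eqI[of _ _ u]) simp_all
  qed
  have finW: "finite ?W" using finite_lists_length_eq[OF fin] .
  show "finite (generated \<Omega> ar opr D n)" by (rule finite_subset[OF sub finite_imageI[OF finW]])
  have "card (generated \<Omega> ar opr D n) \<le> card ?W"
    using surj_card_le[OF finW sub] .
  then show "card (generated \<Omega> ar opr D n) \<le> card (alphabet \<Omega>) ^ n"
    using card_lists_length_eq[OF fin] by simp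
qed

section \<open>Enumerated generators and additional elements\<close>

text \<open>The generator \<open>e c\<close> has degree \<open>c + 1\<close>, and for \<open>n \<in> X\<close> the element \<open>x n\<close> is added in degree \<open>n\<close>.
  Degree \<open>0\<close> is left empty, as generators of degree \<open>0\<close> could occur in terms at no cost.\<close>

definition gens_with :: "(nat \<Rightarrow> 'a) \<Rightarrow> nat set \<Rightarrow> (nat \<Rightarrow> 'a) \<Rightarrow> nat \<Rightarrow> 'a set"
  where "gens_with e X x n =
    (if n = 0 then {} else insert (e (n - 1)) (if n \<in> X then {x n} else {}))"

lemma gens_with_0: "gens_with e X x 0 = {}"
  by (simp add: gens_with_def)

lemma gens_with_Suc: "gens_with e X x (Suc c) \<subseteq> {e c, x (Suc c)}"
  by (auto simp: gens_with_def)

lemma gens_with_subset: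
  "range e \<subseteq> A \<Longrightarrow> (\<And>n. n \<in> X \<Longrightarrow> x n \<in> A) \<Longrightarrow> gens_with e X x n \<subseteq> A"
  by (auto simp: gens_with_def)

lemma gens_with_growth:
  assumes "finite \<Omega>"
  shows "finite (generated \<Omega> ar opr (gens_with e X x) n)"
    and "card (generated \<Omega> ar opr (gens_with e X x) n) \<le> card (alphabet \<Omega>) ^ n"
  using generated_growth[where p = e and q = "\<lambda>c. x (Suc c)", 
    OF assms gens_with_0[of e X x] gens_with_Suc[of e X x]]
  by blast+

lemma infinite_rationals_between:
  fixes r s :: real
  assumes "r < s"
  shows "infinite {q \<in> \<rat>. r < q \<and> q < s}"
proof
  let ?Q = "{q \<in> \<rat>. r < q \<and> q < s}"
  assume fin: "finite ?Q"
  have "?Q \<noteq> {}" using Rats_dense_in_real[OF assms] by auto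
  then have "Min ?Q \<in> ?Q" using fin Min_in by blast
  then have "r < Min ?Q" "Min ?Q < s" by auto
  from Rats_dense_in_real[OF this(1)] obtain q where "q \<in> \<rat>" "r < q" "q < Min ?Q" by blast
  moreover from this have "q \<in> ?Q" using \<open>Min ?Q < s\<close> by auto
  then have "Min ?Q \<le> q" using fin by simp
  ultimately show False by simp
qed

text \<open>Additional degrees are taken among the values \<open>fact (k + 1)\<close>, since the quotients of consecutive
  values tend to infinity.
  Indexing by the rationals below \<open>r\<close> yields a chain of sets of degrees in which any two members
  have an infinite difference.\<close>

definition real_degrees :: "real \<Rightarrow> nat set"
  where "real_degrees r = {fact (Suc k) | k. real_of_rat (nat_to_rat_surj k) < r}"

text \<open>For the index \<open>k\<close> of a rational number in \<open>(r, s)\<close> with \<open>k \<ge> t\<close>, no degree used for \<open>r\<close>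
  lies between \<open>n = fact (k + 1)\<close> and \<open>t * n\<close>.\<close>

lemma real_degrees_gap:
  assumes "r < s"
  obtains n where "n > 0" "n \<in> real_degrees s" "t \<le> n"
    "\<And>m. m \<in> real_degrees r \<Longrightarrow> m \<le> t * n \<Longrightarrow> m < n"
proof -
  let ?\<rho> = "\<lambda>k. real_of_rat (nat_to_rat_surj k)"
  let ?K = "{k. r < ?\<rho> k \<and> ?\<rho> k < s}"
  have "{q \<in> \<rat>. r < q \<and> q < s} \<subseteq> ?\<rho> ` ?K"
    by (auto simp: Rats_eq_range_of_rat_o_nat_to_rat_surj)
  then have "infinite ?K"
    using infinite_rationals_between[OF assms] by (meson finite_imageI finite_subset)
  then obtain k where k: "k \<ge> t" "r < ?\<rho> k" "?\<rho> k < s"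
    unfolding infinite_nat_iff_unbounded_le by blast
  let ?n = "fact (Suc k) :: nat"
  have "k \<le> ?n" using fact_ge_self[of "Suc k"] by linarith
  have "m < ?n" if m: "m \<in> real_degrees r" "m \<le> t * ?n" for m
  proof -
    from m(1) obtain j where j: "m = fact (Suc j)" "?\<rho> j < r"
      by (auto simp: real_degrees_def)
    have "j \<noteq> k" using j k by auto
    moreover have "\<not> k < j"
    proof
      assume "k < j"
      then have "(fact (Suc (Suc k)) :: nat) \<le> m"
        unfolding j by (intro fact_mono_nat) auto
      moreover have "(fact (Suc (Suc k)) :: nat) = Suc (Suc k) * ?n" by simp
      moreover have "t * ?n < Suc (Suc k) * ?n"
        using k(1) by (intro mult_strict_right_mono) (auto simp del: fact_Suc)
      ultimately show False using m(2) by linarith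
    qed
    ultimately have "j < k" by simp
    then show ?thesis unfolding j by (intro fact_less_mono_nat) auto
  qed
  moreover have "?n \<in> real_degrees s" using k by (auto simp: real_degrees_def)
  moreover have "t \<le> ?n" using k(1) \<open>k \<le> ?n\<close> by linarith
  ultimately show ?thesis by (intro that[of ?n]) (auto simp del: fact_Suc)
qed

section \<open>Elements far away\<close>

text \<open>The set and the linear case are treated together: \<open>cl\<close> is the identity for sets and the span for
  vector spaces, and \<open>tame\<close> the respective notion of a tame filtration. The assumption
  \<open>escape\<close> provides elements far away, and \<open>tame_absorbs\<close> makes the minimum in the definition of the
  distortion exist.\<close>

locale tame_family =
  fixes \<Omega> :: "'o set" and ar :: "'o \<Rightarrow> nat" and opr :: "'o \<Rightarrow> 'a list \<Rightarrow> 'a" and A :: "'a set"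
    and e :: "nat \<Rightarrow> 'a" and cl :: "'a set \<Rightarrow> 'a set" and tame :: "(nat \<Rightarrow> 'a set) \<Rightarrow> bool"
  assumes finite_ops: "finite \<Omega>"
    and closed: "\<And>\<omega> xs. \<omega> \<in> \<Omega> \<Longrightarrow> length xs = ar \<omega> \<Longrightarrow> set xs \<subseteq> A \<Longrightarrow> opr \<omega> xs \<in> A"
    and enum_subset: "range e \<subseteq> A"
    and cl_mono: "\<And>S T. S \<subseteq> T \<Longrightarrow> cl S \<subseteq> cl T"
    and cl_superset: "\<And>S. S \<subseteq> cl S"
    and escape: "\<And>S. finite S \<Longrightarrow> S \<subseteq> A \<Longrightarrow> \<exists>x\<in>A. x \<notin> cl S"
    and tame_generated: "\<And>X x. (\<And>n. x n \<in> A) \<Longrightarrow>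
      tame (\<lambda>n. cl (generated \<Omega> ar opr (gens_with e X x) n))"
    and tame_absorbs: "\<And>\<alpha> \<beta> n. tame \<alpha> \<Longrightarrow> tame \<beta> \<Longrightarrow> \<exists>m. \<alpha> n \<subseteq> \<beta> m"
begin

abbreviation F :: "nat set \<Rightarrow> (nat \<Rightarrow> 'a) \<Rightarrow> nat \<Rightarrow> 'a set"
  where "F X x n \<equiv> cl (generated \<Omega> ar opr (gens_with e X x) n)"

lemma exists_outside:
  assumes "\<And>n. n \<in> X \<Longrightarrow> x n \<in> A"
  shows "\<exists>y\<in>A. y \<notin> F X x N"
proof (rule escape)
  show "finite (generated \<Omega> ar opr (gens_with e X x) N)"
    by (rule gens_with_growth(1)[OF finite_ops])
  show "generated \<Omega> ar opr (gens_with e X x) N \<subseteq> A"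
    by (rule generated_closed[OF closed gens_with_subset[OF enum_subset assms]])
qed

lemma additional_element: "n > 0 \<Longrightarrow> n \<in> X \<Longrightarrow> x n \<in> F X x n"
  by (rule subsetD[OF cl_superset], rule generator_in_generated) (simp add: gens_with_def)

text \<open>A recursive choice is possible because the condition on \<open>x n\<close> only refers to the values of \<open>x\<close>
  below \<open>n\<close>. The bound \<open>n * n\<close> is there to exceed \<open>t * n\<close> for every factor \<open>t\<close> from some \<open>n\<close> on.\<close>

lemma distant_sequence:
  obtains x where "\<And>n. x n \<in> A" "\<And>n. x n \<notin> F {..<n} x (n * n)"
proof -
  have cong: "gens_with e {..<n} x = gens_with e {..<n} y" if "\<And>m. m < n \<Longrightarrow> x m = y m"
    for x y :: "nat \<Rightarrow> 'a" and n
    using that by (auto simp: gens_with_def fun_eq_iff)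
  have "\<exists>x. \<forall>n. x n \<in> A \<and> x n \<notin> F {..<n} x (n * n)"
  proof (rule dependent_wf_choice[of "{(m, n). m < n}"])
    show "wf {(m, n :: nat). m < n}" by (rule wf)
  next
    fix x y :: "nat \<Rightarrow> 'a" and n z
    assume "\<And>m. (m, n) \<in> {(m, n). m < n} \<Longrightarrow> x m = y m"
    then have "gens_with e {..<n} x = gens_with e {..<n} y" by (intro cong) simp
    then show "(z \<in> A \<and> z \<notin> F {..<n} x (n * n)) = (z \<in> A \<and> z \<notin> F {..<n} y (n * n))"
      by simp
  next
    fix n and x :: "nat \<Rightarrow> 'a"
    assume "\<And>m. (m, n) \<in> {(m, n). m < n} \<Longrightarrow> x m \<in> A \<and> x m \<notin> F {..<m} x (m * m)"
    then show "\<exists>z. z \<in> A \<and> z \<notin> F {..<n} x (n * n)"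
      using exists_outside[of "{..<n}" x] by auto
  qed
  then show ?thesis using that by blast
qed

text \<open>In degrees up to \<open>t * n\<close> at a gap \<open>n\<close>, the filtration for \<open>r\<close> is contained in the one with all
  additional elements of degree below \<open>n\<close>, which \<open>x n\<close> avoids by choice.\<close>

lemma not_equivalent:
  assumes x: "\<And>n. x n \<notin> F {..<n} x (n * n)" and "r < s"
  shows "\<exists>n. \<not> F (real_degrees s) x n \<subseteq> F (real_degrees r) x (t * n)"
proof -
  obtain n where n: "n > 0" "n \<in> real_degrees s" "t \<le> n"
    "\<And>m. m \<in> real_degrees r \<Longrightarrow> m \<le> t * n \<Longrightarrow> m < n"
    using real_degrees_gap[OF \<open>r < s\<close>] by metis
  have "generated \<Omega> ar opr (gens_with e (real_degrees r) x) (t * n)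
      \<subseteq> generated \<Omega> ar opr (gens_with e {..<n} x) (t * n)"
    using n(4) by (intro generated_local) (auto simp: gens_with_def)
  also have "\<dots> \<subseteq> generated \<Omega> ar opr (gens_with e {..<n} x) (n * n)"
    using n(3) by (intro generated_mono) simp
  finally have "F (real_degrees r) x (t * n) \<subseteq> F {..<n} x (n * n)" by (rule cl_mono)
  then have "x n \<notin> F (real_degrees r) x (t * n)" using x by blast
  moreover have "x n \<in> F (real_degrees s) x n" using n by (intro additional_element) auto
  ultimately show ?thesis by blast
qed

theorem continuum_many:
  "\<exists>S. (\<forall>\<alpha>\<in>S. tame \<alpha>) \<and> pairwise (\<lambda>\<alpha> \<beta>. \<not> equivalent_filtrations \<alpha> \<beta>) S
    \<and> (UNIV :: real set) \<lesssim> S"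
proof -
  obtain x where x: "\<And>n. x n \<in> A" "\<And>n. x n \<notin> F {..<n} x (n * n)"
    using distant_sequence by blast
  define \<Phi> where "\<Phi> r = F (real_degrees r) x" for r
  have less: "\<not> equivalent_filtrations (\<Phi> r) (\<Phi> s) \<and> \<not> equivalent_filtrations (\<Phi> s) (\<Phi> r)"
    if "r < s" for r s
    using not_equivalent[OF x(2) that] unfolding equivalent_filtrations_def \<Phi>_def by blast
  then have neq: "\<not> equivalent_filtrations (\<Phi> r) (\<Phi> s)" if "r \<noteq> s" for r s
    using that by (metis linorder_neqE)
  have refl: "equivalent_filtrations \<alpha> \<alpha>" for \<alpha> :: "nat \<Rightarrow> 'a set"
    unfolding equivalent_filtrations_def by (intro exI[of _ 1]) simp
  have "inj \<Phi>" using neq refl by (metis injI)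
  then have "(UNIV :: real set) \<lesssim> range \<Phi>" by (auto simp: lepoll_def)
  moreover have "tame (\<Phi> r)" for r unfolding \<Phi>_def using x(1) by (rule tame_generated)
  moreover have "pairwise (\<lambda>\<alpha> \<beta>. \<not> equivalent_filtrations \<alpha> \<beta>) (range \<Phi>)"
    using neq unfolding pairwise_def by (metis imageE)
  ultimately show ?thesis by blast
qed

theorem large_distortion:
  "\<exists>\<alpha> \<alpha>'. tame \<alpha> \<and> tame \<alpha>' \<and> (\<forall>n>0. distortion \<alpha> \<alpha>' n > g n)"
proof -
  \<comment> \<open>For \<open>X = {}\<close> nothing is added to the enumeration, and the argument \<open>e\<close> is a dummy.\<close>
  have "\<exists>y\<in>A. y \<notin> F {} e (g n)" for n by (rule exists_outside) auto
  then obtain x where x: "\<And>n. x n \<in> A" "\<And>n. x n \<notin> F {} e (g n)" by metis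
  have tame: "tame (F UNIV x)" "tame (F {} e)"
    using x(1) enum_subset by (auto intro!: tame_generated)
  have "distortion (F UNIV x) (F {} e) n > g n" if "n > 0" for n
  proof (rule ccontr)
    assume "\<not> ?thesis"
    moreover have "F UNIV x n \<subseteq> F {} e (distortion (F UNIV x) (F {} e) n)"
      unfolding distortion_def using tame_absorbs[OF tame] by (rule LeastI_ex)
    ultimately have "F UNIV x n \<subseteq> F {} e (g n)"
      using cl_mono[OF generated_mono] by (meson dual_order.trans not_le_imp_less)
    then show False using additional_element[OF that, of UNIV x] x(2) by blast
  qed
  with tame show ?thesis by blast
qed

end

section \<open>Sets and vector spaces\<close>

lemma finite_subset_of_chain:
  fixes \<beta> :: "nat \<Rightarrow> 'a set"
  assumes "\<And>n. \<beta> n \<subseteq> \<beta> (Suc n)" "finite V" "V \<subseteq> (\<Union>n. \<beta> n)"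
  shows "\<exists>m. V \<subseteq> \<beta> m"
  using assms(2,3)
proof (induction V rule: finite_induct)
  case empty
  then show ?case by simp
next
  case (insert v V)
  then obtain m k where "V \<subseteq> \<beta> m" "v \<in> \<beta> k" by blast
  moreover have "\<beta> i \<subseteq> \<beta> (max m k)" if "i \<le> max m k" for i
    using lift_Suc_mono_le[of \<beta>] assms(1) that by blast
  ultimately have "insert v V \<subseteq> \<beta> (max m k)"
    by (meson insert_subset max.cobounded1 max.cobounded2 subsetD subset_trans)
  then show ?case ..
qed

lemma alphabet_growth_constant:
  assumes "finite \<Omega>"
  shows "real (card (alphabet \<Omega>)) > 0"
proof -
  have "finite (alphabet \<Omega>)" "alphabet \<Omega> \<noteq> {}" using assms by (auto simp: alphabet_def)
  then show ?thesis by (simp add: card_gt_0_iff)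
qed

lemma tame_family_set:
  fixes \<Omega> :: "'o set" and A :: "'a set"
  assumes "finite \<Omega>" "omega_algebra \<Omega> ar opr A" "countable A" "infinite A"
  shows "tame_family \<Omega> ar opr A (from_nat_into A) (\<lambda>S. S) (tame_filtration \<Omega> ar opr A)"
proof -
  interpret omega_algebra \<Omega> ar opr A by fact
  let ?e = "from_nat_into A"
  have e: "range ?e = A" using assms(3,4) by (simp add: infinite_imp_nonempty)
  show ?thesis
  proof
    fix X and x :: "nat \<Rightarrow> 'a"
    assume x: "\<And>n. x n \<in> A"
    let ?D = "gens_with ?e X x"
    let ?G = "generated \<Omega> ar opr ?D"
    note growth = gens_with_growth[OF assms(1), of ar opr ?e X x]
    have "?G n \<subseteq> A" for n
      by (rule generated_closed[OF opr_closed gens_with_subset[OF equalityD1[OF e] x]])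
    moreover have "?e c \<in> ?G (Suc c)" for c
      by (rule generator_in_generated) (simp add: gens_with_def)
    then have "range ?e \<subseteq> (\<Union>n. ?G n)" by blast
    ultimately have "(\<Union>n. ?G n) = A" unfolding e by blast
    then have "filtration_chain \<Omega> ar opr A ?G"
      unfolding filtration_chain_def
      by (intro conjI allI ballI impI generated_mono operation_in_generated) simp_all
    moreover have "real (card (?G n)) \<le> real (card (alphabet \<Omega>)) ^ n" for n
      using growth(2)[of n] by (metis of_nat_le_iff of_nat_power)
    ultimately show "tame_filtration \<Omega> ar opr A ?G"
      unfolding tame_filtration_def filtration_def
      using growth(1) alphabet_growth_constant[OF assms(1)] by blast
  next
    fix \<alpha> \<beta> :: "nat \<Rightarrow> 'a set" and n
    assume "tame_filtration \<Omega> ar opr A \<alpha>" "tame_filtration \<Omega> ar opr A \<beta>"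
    then show "\<exists>m. \<alpha> n \<subseteq> \<beta> m"
      unfolding tame_filtration_def filtration_def filtration_chain_def
      by (intro finite_subset_of_chain) auto
  next
    fix S assume "finite S" "S \<subseteq> A"
    then show "\<exists>x\<in>A. x \<notin> S" using assms(4) by (metis finite_subset subsetI)
  qed (use assms(1) opr_closed e in auto)
qed

context linear_omega_algebra
begin

text \<open>By multilinearity the arguments can be moved from the spanning sets to their spans one position
  after another; the first \<open>i\<close> positions are those already treated.\<close>

lemma operation_in_span:
  assumes \<omega>: "\<omega> \<in> \<Omega>" "length xs = ar \<omega>" "length Gs = ar \<omega>"
    and H: "\<And>ys. list_all2 (\<in>) ys Gs \<Longrightarrow> opr \<omega> ys \<in> H"
    and xs: "list_all2 (\<lambda>x G. x \<in> span G) xs Gs"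
  shows "opr \<omega> xs \<in> span H"
proof -
  have "opr \<omega> ys \<in> span H"
    if "i \<le> ar \<omega>" "length ys = ar \<omega>" "\<And>j. j < i \<Longrightarrow> ys ! j \<in> span (Gs ! j)"
      "\<And>j. i \<le> j \<Longrightarrow> j < ar \<omega> \<Longrightarrow> ys ! j \<in> Gs ! j" for i ys
    using that
  proof (induction i arbitrary: ys)
    case 0
    then have "list_all2 (\<in>) ys Gs" using \<omega> by (simp add: list_all2_conv_all_nth)
    then show ?case using H span_base by blast
  next
    case (Suc i)
    let ?f = "\<lambda>z. opr \<omega> (ys[i := z])"
    have lin: "Vector_Spaces.linear scale scale ?f"
      using Suc.prems \<omega> by (intro opr_multilinear) auto
    have image: "?f z \<in> span H" if "z \<in> Gs ! i" for z
    proof (rule Suc.IH)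
      fix j assume "i \<le> j" "j < ar \<omega>"
      then show "ys[i := z] ! j \<in> Gs ! j"
        using Suc.prems that by (cases "j = i") auto
    qed (use Suc.prems in auto)
    interpret f: Vector_Spaces.linear scale scale ?f by (rule lin)
    have "?f ` span (Gs ! i) \<subseteq> span H"
      unfolding f.span_image[symmetric] using image by (intro span_minimal) auto
    moreover have "ys ! i \<in> span (Gs ! i)" using Suc.prems by auto
    ultimately have "?f (ys ! i) \<in> span H" by blast
    then show ?case by simp
  qed
  from this[of "ar \<omega>" xs] show ?thesis
    using \<omega> xs by (simp add: list_all2_conv_all_nth)
qed

lemma span_generated_chain:
  assumes "span (\<Union>k. D k) = UNIV"
  shows "filtration_chain \<Omega> ar opr UNIV (\<lambda>n. span (generated \<Omega> ar opr D n))"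
proof -
  let ?G = "generated \<Omega> ar opr D"
  have mono: "span (?G m) \<subseteq> span (?G n)" if "m \<le> n" for m n
    using generated_mono[OF that] by (rule span_mono)
  have "(\<Union>n. span (?G n)) = UNIV"
  proof -
    have "subspace (\<Union>n. span (?G n))"
    proof (rule subspaceI)
      fix u v assume "u \<in> (\<Union>n. span (?G n))" "v \<in> (\<Union>n. span (?G n))"
      then obtain m n where "u \<in> span (?G m)" "v \<in> span (?G n)" by blast
      then have "u \<in> span (?G (max m n))" "v \<in> span (?G (max m n))"
        using mono[of m "max m n"] mono[of n "max m n"] by auto
      then show "u + v \<in> (\<Union>n. span (?G n))" using span_add by blast
    qed (auto intro: span_zero span_scale)
    moreover have "(\<Union>k. D k) \<subseteq> (\<Union>n. span (?G n))"
      using generator_in_generated[of _ D] by (fast intro: span_base)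
    ultimately have "span (\<Union>k. D k) \<subseteq> (\<Union>n. span (?G n))" by (intro span_minimal)
    then show ?thesis unfolding assms by (rule top.extremum_uniqueI)
  qed
  moreover have "opr \<omega> xs \<in> span (?G (sum_list ks + 1))"
    if "\<omega> \<in> \<Omega>" "length xs = ar \<omega>" "list_all2 (\<lambda>x k. x \<in> span (?G k)) xs ks" for \<omega> xs ks
  proof (rule operation_in_span)
    show "length (map ?G ks) = ar \<omega>" using that list_all2_lengthD by fastforce
    show "list_all2 (\<lambda>x G. x \<in> span G) xs (map ?G ks)" using that by (simp add: list_all2_map2)
    fix ys assume ys: "list_all2 (\<in>) ys (map ?G ks)"
    then have "length ys = ar \<omega>" using that by (metis length_map list_all2_lengthD)
    then show "opr \<omega> ys \<in> ?G (sum_list ks + 1)"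
      using ys that by (intro operation_in_generated) (auto simp: list_all2_map2)
  qed (use that in auto)
  ultimately show ?thesis
    unfolding filtration_chain_def by (intro conjI allI ballI impI mono) simp_all
qed

lemma tame_family_linear:
  assumes "finite \<Omega>" and B: "independent B" "span B = UNIV" "countable B" "infinite B"
  shows "tame_family \<Omega> ar opr UNIV (from_nat_into B) span tame_linear_filtration"
proof -
  let ?e = "from_nat_into B"
  have e: "range ?e = B" using B by (simp add: infinite_imp_nonempty)
  show ?thesis
  proof
    fix X and x :: "nat \<Rightarrow> 'v"
    let ?D = "gens_with ?e X x"
    let ?G = "generated \<Omega> ar opr ?D"
    note growth = gens_with_growth[OF assms(1), of ar opr ?e X x]
    have "?e c \<in> ?D (Suc c)" for c by (simp add: gens_with_def)
    then have "range ?e \<subseteq> (\<Union>k. ?D k)" by blast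
    from span_mono[OF this[unfolded e]] have "span (\<Union>k. ?D k) = UNIV" using B(2) by auto
    then have "filtration_chain \<Omega> ar opr UNIV (\<lambda>n. span (?G n))" by (rule span_generated_chain)
    moreover have "finite_dim (span (?G n))" for n
      unfolding finite_dim_def using growth(1) by blast
    moreover have "real (dim (span (?G n))) \<le> real (card (alphabet \<Omega>)) ^ n" for n
    proof -
      have "dim (span (?G n)) \<le> card (?G n)" using growth(1) by (intro dim_le_card) auto
      also have "\<dots> \<le> card (alphabet \<Omega>) ^ n" by (rule growth(2))
      finally show ?thesis by (metis of_nat_le_iff of_nat_power)
    qed
    ultimately show "tame_linear_filtration (\<lambda>n. span (?G n))"
      unfolding tame_linear_filtration_def linear_filtration_def
      using alphabet_growth_constant[OF assms(1)] by blast
  next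
    fix \<alpha> \<beta> :: "nat \<Rightarrow> 'v set" and n
    assume \<alpha>: "tame_linear_filtration \<alpha>" and \<beta>: "tame_linear_filtration \<beta>"
    from \<alpha> obtain V where V: "finite V" "span V = \<alpha> n"
      unfolding tame_linear_filtration_def linear_filtration_def finite_dim_def by blast
    have "\<exists>m. V \<subseteq> \<beta> m"
      using \<beta> V(1) unfolding tame_linear_filtration_def linear_filtration_def filtration_chain_def
      by (intro finite_subset_of_chain) auto
    then show "\<exists>m. \<alpha> n \<subseteq> \<beta> m"
      using \<beta> V(2) span_minimal unfolding tame_linear_filtration_def linear_filtration_def by metis
  next
    fix S :: "'v set" assume "finite S"
    then have "span S \<noteq> UNIV" using independent_span_bound B by auto
    then show "\<exists>x\<in>UNIV. x \<notin> span S" by blast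
  qed (use assms(1) span_mono span_superset in auto)
qed

end

theorem theorem2:
  fixes \<Omega> :: "'o set" and ar :: "'o \<Rightarrow> nat"
    and A :: "'a set" and opr :: "'o \<Rightarrow> 'a list \<Rightarrow> 'a"
    and scale :: "'f::field \<Rightarrow> 'v::ab_group_add \<Rightarrow> 'v" and lopr :: "'o \<Rightarrow> 'v list \<Rightarrow> 'v"
  assumes "finite \<Omega>"
  shows
    "(omega_algebra \<Omega> ar opr A \<and> countable A \<and> infinite A \<longrightarrow>
       (\<exists>S. (\<forall>\<alpha>\<in>S. tame_filtration \<Omega> ar opr A \<alpha>)
          \<and> pairwise (\<lambda>\<alpha> \<beta>. \<not> equivalent_filtrations \<alpha> \<beta>) S
          \<and> (UNIV :: real set) \<lesssim> S) \<and>
       (\<forall>g :: nat \<Rightarrow> nat. \<exists>\<alpha> \<alpha>'. tame_filtration \<Omega> ar opr A \<alpha> \<and> tame_filtration \<Omega> ar opr A \<alpha>'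
          \<and> (\<forall>n>0. distortion \<alpha> \<alpha>' n > g n)))
     \<and>
     (linear_omega_algebra scale \<Omega> ar lopr \<and> linear_omega_algebra.countably_infinite_dim scale \<longrightarrow>
       (\<exists>S. (\<forall>\<alpha>\<in>S. linear_omega_algebra.tame_linear_filtration scale \<Omega> ar lopr \<alpha>)
          \<and> pairwise (\<lambda>\<alpha> \<beta>. \<not> equivalent_filtrations \<alpha> \<beta>) S
          \<and> (UNIV :: real set) \<lesssim> S) \<and>
       (\<forall>g :: nat \<Rightarrow> nat. \<exists>\<alpha> \<alpha>'. linear_omega_algebra.tame_linear_filtration scale \<Omega> ar lopr \<alpha>
          \<and> linear_omega_algebra.tame_linear_filtration scale \<Omega> ar lopr \<alpha>'
          \<and> (\<forall>n>0. distortion \<alpha> \<alpha>' n > g n)))"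
proof (intro conjI[of "_ \<longrightarrow> _"] impI; elim conjE)
  assume "omega_algebra \<Omega> ar opr A" "countable A" "infinite A"
  with assms interpret tame_family \<Omega> ar opr A "from_nat_into A" "\<lambda>S. S"
    "tame_filtration \<Omega> ar opr A"
    by (intro tame_family_set)
  show "(\<exists>S. (\<forall>\<alpha>\<in>S. tame_filtration \<Omega> ar opr A \<alpha>)
        \<and> pairwise (\<lambda>\<alpha> \<beta>. \<not> equivalent_filtrations \<alpha> \<beta>) S \<and> (UNIV :: real set) \<lesssim> S) \<and>
      (\<forall>g :: nat \<Rightarrow> nat. \<exists>\<alpha> \<alpha>'. tame_filtration \<Omega> ar opr A \<alpha> \<and> tame_filtration \<Omega> ar opr A \<alpha>'
        \<and> (\<forall>n>0. distortion \<alpha> \<alpha>' n > g n))"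
    using continuum_many large_distortion by blast
next
  assume lin: "linear_omega_algebra scale \<Omega> ar lopr"
    and dim: "linear_omega_algebra.countably_infinite_dim scale"
  interpret linear_omega_algebra scale \<Omega> ar lopr by fact
  from dim obtain B where
    "independent B" "span B = UNIV" "countable B" "infinite B"
    unfolding countably_infinite_dim_def by blast
  with assms interpret tame_family \<Omega> ar lopr UNIV "from_nat_into B" span tame_linear_filtration
    by (intro tame_family_linear)
  show "(\<exists>S. (\<forall>\<alpha>\<in>S. tame_linear_filtration \<alpha>)
        \<and> pairwise (\<lambda>\<alpha> \<beta>. \<not> equivalent_filtrations \<alpha> \<beta>) S \<and> (UNIV :: real set) \<lesssim> S) \<and>
      (\<forall>g :: nat \<Rightarrow> nat. \<exists>\<alpha> \<alpha>'. tame_linear_filtration \<alpha> \<and> tame_linear_filtration \<alpha>'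
        \<and> (\<forall>n>0. distortion \<alpha> \<alpha>' n > g n))"
    using continuum_many large_distortion by blast
qed

end
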